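(* Let $n,k\geq 1$. For every forest $F\in\widehat{\mathcal{F}}^*_n(k)$ and every subset $S\subseteq\mathrm{Oint}(F)$, the forest $F'=\Phi_S(F)$ belongs to $\widehat{\mathcal{F}}_n(k)$ and satisfies $\mathrm{rleaf}(F')=0$, $\mathrm{Si}^*(F')=\mathrm{Si}^*(F)$, and $\mathrm{lleaf}(F')-\mathrm{si}(F')=\mathrm{lleaf}(F)-\mathrm{si}(F)+|S|$.
   Context: Trees: all trees are ordered (plane) rooted trees; the level of a node is its distance from the root (root at level 0); a leaf is a node with no children. An even $k$-ary tree is an ordered tree in which every node on an even level has exactly $k$ children. A pruned even $k$-ary tree is obtained from an even $k$-ary tree by deleting, for every even-level node all of whose children are leaves, all those children. An increasing pruned even $k$-ary tree on a set $M$ of positive integers is a pruned even $k$-ary tree whose nodes on even levels are labeled bijectively by $M$ (odd-level nodes unlabeled) such that labels increase along every path from the root downward and, for each node, the labels of its children increase from left to right. $\mathcal{F}_n(k)$ is the set of sequences $F=(T_1,\dots,T_m)$ of such trees whose label sets partition $[n]$ and whose root labels increase left to right. A labeled node is a leaf if it has no children and internal otherwise; $\mathrm{lleaf}(F)$ is the number of labeled leaves of $F$. A singleton is a one-node tree; $\mathrm{si}(F)$ is the number of singletons, $\mathrm{Si}(F)$ the set of their labels. For a labeled node $v$, its grand parent is the labeled node $u$ such that a child of $u$ is the parent of $v$. A labeled non-root node is old if its label is the greatest among all grand children of its grand parent, and young otherwise; roots are neither. $\mathrm{Oint}(F)$ is the set of labels of old internal nodes of $F$, $\mathrm{Yleaf}(F)$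 the set of labels of young leaves. $\Phi_x$ on a tree $T$ (for a label $x$ of node $v$): (i) if $v$ is old internal, with grand parent $u$, children $\mu_1..\mu_k$ of $u$ and children $\nu_1..\nu_k$ of $v$ (left to right), delete each $\nu_j$ and attach the subtrees rooted at children of $\nu_j$ to $\mu_j$, ordering children of $\mu_j$ increasingly; (ii) if $v$ is a young leaf, with grand parent $u$ and children $\mu_1..\mu_k$ of $u$, let $F_j$ be the subtrees of $\mu_j$ whose root labels exceed $x$; attach $k$ new unlabeled children $\nu_1..\nu_k$ to $v$ and move the subtrees in $F_j$ to $\nu_j$, ordering increasingly; (iii) otherwise $\Phi_x(T)=T$. For a set $S$ of labels of $T$, $\Phi_S(T)$ is the composition of the $\Phi_x$, $x\in S$ (these commute when $S\subseteq\mathrm{Oint}(T)$ or $S\subseteq\mathrm{Yleaf}(T)$). For $F=(T_1,\dots,T_m)$ and $S\subseteq\mathrm{Oint}(F)$ or $S\subseteq\mathrm{Yleaf}(F)$, $\Phi_S(F)=(\Phi_{S_1}(T_1),\dots,\Phi_{S_m}(T_m))$ where $S_i$ is the set of elements of $S$ labeling nodes of $T_i$. Removable leaves of $F=(T_1,\dots,T_m)$: an old leaf $u$ of $T_i$ is removable if $u$ is a grand child of the root of $T_i$ and the only leaf among the grand children of that root, the first $k-1$ children of the root of $T_i$ are leaves, and (if $i<m$) the label of $u$ is smaller than the root label of $T_{i+1}$. A young leaf $u\in T_m$ with label $x$ is removable if $u$ is a grand child of the root of $T_m$ and the first $k-1$ children of the root of $\Phi_x(T_m)$ are leaves. $\mathrm{rleaf}(F)$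 is the total number of removable old and removable young leaves. $\overline{\mathcal{F}}_n(k)$ is the set of $F\in\mathcal{F}_n(k)$ whose rightmost tree is a singleton or has the first $k-1$ children of its root being leaves; $\widehat{\mathcal{F}}_n(k)=\mathcal{F}_n(k)\setminus\overline{\mathcal{F}}_n(k)$. $\widehat{\mathcal{F}}^*_n(k)=\{F\in\widehat{\mathcal{F}}_n(k): F \text{ has no young leaves}, \mathrm{rleaf}(F)=0\}$. $\mathrm{Si}^*(F)$ is $\mathrm{Si}(F)$ minus the label of $T_m$ if $T_m$ is a singleton (otherwise $\mathrm{Si}^*(F)=\mathrm{Si}(F)$). *)

theory Defs
  imports Main
begin

text \<open>
  A tree is given by its even-level nodes: \<open>Node x cs\<close> is an even-level node with label \<open>x\<close>, and
  \<open>cs\<close> lists its (unlabeled, odd-level) children from left to right, each such child being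
  represented by the list of the subtrees rooted at its own children. Thus an odd-level node
  is a leaf iff it is \<open>[]\<close>, and a labeled node is a leaf iff its list of children is \<open>[]\<close>.
\<close>

datatype ltree = Node (label: nat) (children: "ltree list list")

definition leaf :: "ltree \<Rightarrow> bool" where
  "leaf t \<longleftrightarrow> children t = []"

definition gchildren :: "ltree \<Rightarrow> ltree list" where
  "gchildren t = concat (children t)"

text \<open>A labeled node is identified with the subtree rooted at it.\<close>

fun nodes :: "ltree \<Rightarrow> ltree list" where
  "nodes (Node x cs) = Node x cs # concat (map (\<lambda>c. concat (map nodes c)) cs)"

definition labels :: "ltree \<Rightarrow> nat set" where
  "labels t = label ` set (nodes t)"

fun even_kary :: "nat \<Rightarrow> ltree \<Rightarrow> bool" where
  "even_kary k (Node x cs) \<longleftrightarrow> length cs = k \<and> (\<forall>c\<in>set cs. \<forall>t\<in>set c. even_kary k t)"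

fun prune :: "ltree \<Rightarrow> ltree" where
  "prune (Node x cs) =
     (if \<forall>c\<in>set cs. c = [] then Node x [] else Node x (map (map prune) cs))"

definition pruned_even_kary :: "nat \<Rightarrow> ltree \<Rightarrow> bool" where
  "pruned_even_kary k t \<longleftrightarrow> (\<exists>s. even_kary k s \<and> t = prune s)"

definition increasing :: "ltree \<Rightarrow> bool" where
  "increasing t \<longleftrightarrow> (\<forall>u\<in>set (nodes t).
     (\<forall>v\<in>set (gchildren u). label u < label v) \<and>
     (\<forall>c\<in>set (children u). sorted_wrt (<) (map label c)))"

definition increasing_pruned_tree_on :: "nat \<Rightarrow> nat set \<Rightarrow> ltree \<Rightarrow> bool" where
  "increasing_pruned_tree_on k M t \<longleftrightarrow>
     pruned_even_kary k t \<and> distinct (map label (nodes t)) \<and> labels t = M \<and> increasing t"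

text \<open>The sets \<open>\<F>\<^sub>n(k)\<close>.\<close>

definition forests :: "nat \<Rightarrow> nat \<Rightarrow> ltree list set" where
  "forests n k = {F.
     (\<forall>t\<in>set F. increasing_pruned_tree_on k (labels t) t) \<and>
     (\<forall>i j. i < j \<and> j < length F \<longrightarrow> labels (F ! i) \<inter> labels (F ! j) = {}) \<and>
     (\<Union>t\<in>set F. labels t) = {1..n} \<and>
     sorted_wrt (<) (map label F)}"

definition lleaf :: "ltree list \<Rightarrow> nat" where
  "lleaf F = length (filter leaf (concat (map nodes F)))"

definition si :: "ltree list \<Rightarrow> nat" where
  "si F = length (filter leaf F)"

definition Si :: "ltree list \<Rightarrow> nat set" where
  "Si F = {label t |t. t \<in> set F \<and> leaf t}"

definition Si_star :: "ltree list \<Rightarrow> nat set" where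
  "Si_star F = (if leaf (last F) then Si F - {label (last F)} else Si F)"

definition greatest_in :: "ltree \<Rightarrow> ltree list \<Rightarrow> bool" where
  "greatest_in v ws \<longleftrightarrow> label v = Max (label ` set ws)"

definition old_nodes :: "ltree \<Rightarrow> ltree set" where
  "old_nodes t = {v. \<exists>u\<in>set (nodes t). v \<in> set (gchildren u) \<and> greatest_in v (gchildren u)}"

definition young_nodes :: "ltree \<Rightarrow> ltree set" where
  "young_nodes t = {v. \<exists>u\<in>set (nodes t). v \<in> set (gchildren u) \<and> \<not> greatest_in v (gchildren u)}"

definition Oint :: "ltree list \<Rightarrow> nat set" where
  "Oint F = {label v |v. \<exists>t\<in>set F. v \<in> old_nodes t \<and> \<not> leaf v}"

definition Yleaf :: "ltree list \<Rightarrow> nat set" where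
  "Yleaf F = {label v |v. \<exists>t\<in>set F. v \<in> young_nodes t \<and> leaf v}"

text \<open>
  The action at a grand child \<open>v\<close>, where \<open>cs\<close> is the list of children \<open>\<mu>\<^sub>1, \<dots>, \<mu>\<^sub>k\<close> of the
  grand parent; the result is the new list of children of the grand parent.
\<close>

definition phi_local :: "ltree \<Rightarrow> ltree list list \<Rightarrow> ltree list list" where
  "phi_local v cs =
    (let x = label v;
         replace = (\<lambda>v'. map (\<lambda>w. if label w = x then v' else w))
     in if greatest_in v (concat cs) \<and> \<not> leaf v then
          map2 (\<lambda>\<mu> \<nu>. sort_key label (replace (Node x []) \<mu> @ \<nu>)) cs (children v)
        else if \<not> greatest_in v (concat cs) \<and> leaf v then
          (let \<nu>s = map (\<lambda>\<mu>. sort_key label (filter (\<lambda>w. x < label w) \<mu>)) cs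
           in map (\<lambda>\<mu>. replace (Node x \<nu>s) (filter (\<lambda>w. \<not> x < label w) \<mu>)) cs)
        else cs)"

text \<open>
  The map \<open>\<Phi>\<^sub>x\<close>. The recursion searches for the grand parent of the node labeled \<open>x\<close>; if there
  is none (\<open>x\<close> labels the root), the tree is unchanged.
\<close>

fun phi :: "nat \<Rightarrow> ltree \<Rightarrow> ltree" where
  "phi x (Node y cs) =
     (case find (\<lambda>w. label w = x) (concat cs) of
        Some v \<Rightarrow> Node y (phi_local v cs)
      | None \<Rightarrow> Node y (map (map (phi x)) cs))"

text \<open>
  The maps \<open>\<Phi>\<^sub>x\<close>, \<open>x \<in> S\<close>, commute on a tree all of whose labels in \<open>S\<close> are old internal (or all
  of whose labels in \<open>S\<close> are young leaves), so composing them in increasing order of the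
  labels is merely a choice of representative.
\<close>

definition phi_set :: "nat set \<Rightarrow> ltree \<Rightarrow> ltree" where
  "phi_set S t = fold phi (sorted_list_of_set S) t"

definition Phi :: "nat set \<Rightarrow> ltree list \<Rightarrow> ltree list" where
  "Phi S F = map (\<lambda>t. phi_set (S \<inter> labels t) t) F"

definition first_children_leaves :: "nat \<Rightarrow> ltree \<Rightarrow> bool" where
  "first_children_leaves k t \<longleftrightarrow> (\<forall>c\<in>set (take (k - 1) (children t)). c = [])"

definition removable_old :: "nat \<Rightarrow> ltree list \<Rightarrow> nat set" where
  "removable_old k F = {label u |u. \<exists>i<length F.
     u \<in> old_nodes (F ! i) \<and> leaf u \<and>
     u \<in> set (gchildren (F ! i)) \<and>
     (\<forall>w\<in>set (gchildren (F ! i)). leaf w \<longrightarrow> w = u) \<and>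
     first_children_leaves k (F ! i) \<and>
     (Suc i < length F \<longrightarrow> label u < label (F ! Suc i))}"

definition removable_young :: "nat \<Rightarrow> ltree list \<Rightarrow> nat set" where
  "removable_young k F = {label u |u. F \<noteq> [] \<and>
     u \<in> young_nodes (last F) \<and> leaf u \<and>
     u \<in> set (gchildren (last F)) \<and>
     first_children_leaves k (phi (label u) (last F))}"

definition rleaf :: "nat \<Rightarrow> ltree list \<Rightarrow> nat" where
  "rleaf k F = card (removable_old k F) + card (removable_young k F)"

definition forests_bar :: "nat \<Rightarrow> nat \<Rightarrow> ltree list set" where
  "forests_bar n k = {F \<in> forests n k. leaf (last F) \<or> first_children_leaves k (last F)}"

definition forests_hat :: "nat \<Rightarrow> nat \<Rightarrow> ltree list set" where
  "forests_hat n k = forests n k - forests_bar n k"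

definition forests_hat_star :: "nat \<Rightarrow> nat \<Rightarrow> ltree list set" where
  "forests_hat_star n k = {F \<in> forests_hat n k. Yleaf F = {} \<and> rleaf k F = 0}"

end

theory Submission
  imports Defs "HOL-Library.Multiset"
begin

text \<open>
  Contracting an old internal node \<open>x\<close> keeps every other old internal node old internal, turns \<open>x\<close>
  into a young leaf and changes no other leaf, so the maps \<open>\<Phi>\<^sub>x\<close>, \<open>x \<in> S\<close>, can be analysed one at
  a time. Contracting at a grand child of a root leaves there a leaf that is not the greatest grand
  child, so no old leaf of that tree is removable; contracting deeper changes neither the leaves
  among the grand children of the root nor the emptiness of its children. For young leaves, only the
  last tree \<open>T\<^sub>m\<close> matters: one of the first \<open>k - 1\<close> children of its root has a child \<open>w\<close>, every young
  leaf \<open>x\<close> arising among the grand children of the root satisfies \<open>w \<le> x\<close>, and \<open>\<Phi>\<^sub>x\<close> only moves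
  labels exceeding \<open>x\<close>, so \<open>w\<close> stays in place and \<open>x\<close> is not removable.
\<close>

section \<open>Trees as recursions over the flat list of grand children\<close>

lemma nodes_eq: "nodes t = t # concat (map nodes (gchildren t))"
proof (cases t)
  case (Node x cs)
  have "concat (map (\<lambda>c. concat (map nodes c)) cs) = concat (map nodes (concat cs))"
    by (induction cs) auto
  then show ?thesis by (simp add: Node gchildren_def)
qed

declare nodes.simps [simp del]

lemma set_nodes: "set (nodes t) = insert t (\<Union>w\<in>set (gchildren t). set (nodes w))"
  by (subst nodes_eq) simp

lemma labels_eq: "labels t = insert (label t) (\<Union>w\<in>set (gchildren t). labels w)"
  unfolding labels_def by (subst set_nodes) auto

lemma root_in_nodes [simp]: "t \<in> set (nodes t)"
  by (simp add: set_nodes[of t])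

lemma label_in_labels [simp]: "label t \<in> labels t"
  by (simp add: labels_def)

lemma gchildren_Node [simp]: "gchildren (Node x cs) = concat cs"
  by (simp add: gchildren_def)

lemma ltree_gchildren_induct [case_names gchildren]:
  assumes "\<And>t. (\<And>w. w \<in> set (gchildren t) \<Longrightarrow> P w) \<Longrightarrow> P t"
  shows "P t"
proof (induction t)
  case (Node x cs)
  show ?case by (rule assms) (use Node in auto)
qed

text \<open>A contraction rearranges the nodes of a tree but keeps their labels. As a multiset the
  labels do not depend on the arrangement, yet still determine both the label set and
  distinctness.\<close>

definition label_mset :: "ltree \<Rightarrow> nat multiset" where
  "label_mset t = mset (map label (nodes t))"

lemma label_mset_eq:
  "label_mset t = add_mset (label t) (\<Sum>w\<in>#mset (gchildren t). label_mset w)"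
proof -
  have "mset (map label (concat (map nodes ws))) = (\<Sum>w\<in>#mset ws. label_mset w)" for ws
    by (induction ws) (auto simp: label_mset_def)
  then show ?thesis
    unfolding label_mset_def[of t] by (subst nodes_eq) simp
qed

lemma set_label_mset: "set_mset (label_mset t) = labels t"
  by (simp add: label_mset_def labels_def)

definition leaf_count :: "ltree \<Rightarrow> nat" where
  "leaf_count t = length (filter leaf (nodes t))"

lemma leaf_count_eq:
  "leaf_count t = (if leaf t then 1 else 0) + (\<Sum>w\<in>#mset (gchildren t). leaf_count w)"
proof -
  have "length (filter leaf (concat (map nodes ws))) = (\<Sum>w\<in>#mset ws. leaf_count w)" for ws
    by (induction ws) (auto simp: leaf_count_def)
  then show ?thesis
    unfolding leaf_count_def[of t] by (subst nodes_eq) simp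
qed

section \<open>A local form of being a pruned even \<open>k\<close>-ary tree\<close>

definition pruned_node :: "nat \<Rightarrow> ltree \<Rightarrow> bool" where
  "pruned_node k u \<longleftrightarrow> children u = [] \<or> length (children u) = k \<and> gchildren u \<noteq> []"

text \<open>A right inverse of \<open>prune\<close> on locally pruned trees: it puts
  \<open>k\<close> leaf children back under every labeled leaf and so supplies the witness for
  \<open>pruned_even_kary\<close>.\<close>

fun unprune :: "nat \<Rightarrow> ltree \<Rightarrow> ltree" where
  "unprune k (Node x cs) =
     (if cs = [] then Node x (replicate k []) else Node x (map (map (unprune k)) cs))"

lemma even_kary_unprune:
  "\<forall>u\<in>set (nodes t). pruned_node k u \<Longrightarrow> even_kary k (unprune k t)"
proof (induction t)
  case (Node x cs)
  have "pruned_node k (Node x cs)" using Node.prems by simp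
  moreover have "even_kary k (unprune k w)" if "c \<in> set cs" "w \<in> set c" for c w
    by (rule Node.IH[OF that]) (use Node.prems that in \<open>auto simp: set_nodes[of "Node x cs"]\<close>)
  ultimately show ?case by (auto simp: pruned_node_def)
qed

lemma prune_unprune:
  "\<forall>u\<in>set (nodes t). pruned_node k u \<Longrightarrow> prune (unprune k t) = t"
proof (induction t)
  case (Node x cs)
  have p: "pruned_node k (Node x cs)" using Node.prems by simp
  have "prune (unprune k w) = w" if "c \<in> set cs" "w \<in> set c" for c w
    by (rule Node.IH[OF that]) (use Node.prems that in \<open>auto simp: set_nodes[of "Node x cs"]\<close>)
  then have "map (map (prune \<circ> unprune k)) cs = cs"
    by (intro map_idI) auto
  then show ?case using p by (auto simp: pruned_node_def)
qed

lemma pruned_node_prune: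
  "even_kary k s \<Longrightarrow> u \<in> set (nodes (prune s)) \<Longrightarrow> pruned_node k u"
proof (induction s)
  case (Node x cs)
  show ?case
  proof (cases "\<forall>c\<in>set cs. c = []")
    case True
    then show ?thesis using Node.prems by (simp add: set_nodes[of "Node x []"] pruned_node_def)
  next
    case False
    then have e: "prune (Node x cs) = Node x (map (map prune) cs)" by auto
    \<comment> \<open>\<open>prune\<close> removes no labeled node, so a child of the root that had
      a child before still has one.\<close>
    have "pruned_node k (Node x (map (map prune) cs))"
      using False Node.prems(1) by (auto simp: pruned_node_def)
    moreover have "pruned_node k u" if "c \<in> set cs" "w \<in> set c" "u \<in> set (nodes (prune w))" for c w
      using Node.IH[OF that(1,2)] Node.prems(1) that by auto
    ultimately show ?thesis
      using Node.prems(2) unfolding e set_nodes[of "Node x (map (map prune) cs)"] by auto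
  qed
qed

text \<open>Conditions on single nodes pass to subtrees and can be rechecked at the one node whose
  children change, unlike the existence of an unpruned tree.\<close>

lemma pruned_even_kary_iff: "pruned_even_kary k t \<longleftrightarrow> (\<forall>u\<in>set (nodes t). pruned_node k u)"
  unfolding pruned_even_kary_def
  using pruned_node_prune even_kary_unprune prune_unprune by metis

section \<open>Increasing pruned trees and uniqueness of grand parents\<close>

definition increasing_node :: "ltree \<Rightarrow> bool" where
  "increasing_node u \<longleftrightarrow> (\<forall>v\<in>set (gchildren u). label u < label v) \<and>
     (\<forall>c\<in>set (children u). sorted_wrt (<) (map label c))"

definition valid_tree :: "nat \<Rightarrow> ltree \<Rightarrow> bool" where
  "valid_tree k t \<longleftrightarrow> distinct (map label (nodes t)) \<and>
     (\<forall>u\<in>set (nodes t). pruned_node k u \<and> increasing_node u)"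

lemma increasing_pruned_tree_on_labels_iff:
  "increasing_pruned_tree_on k (labels t) t \<longleftrightarrow> valid_tree k t"
  by (auto simp: increasing_pruned_tree_on_def valid_tree_def increasing_def
      pruned_even_kary_iff increasing_node_def)

lemma distinct_label_nodes:
  "distinct (map label (nodes t)) \<longleftrightarrow> label t \<notin> (\<Union>w\<in>set (gchildren t). labels w) \<and>
     distinct (map label (concat (map nodes (gchildren t))))"
  by (subst nodes_eq) (auto simp: labels_def)

lemma valid_tree_gchild:
  assumes "valid_tree k t" "w \<in> set (gchildren t)"
  shows "valid_tree k w"
proof -
  have "distinct (map label (concat (map nodes (gchildren t))))"
    using assms(1) unfolding valid_tree_def distinct_label_nodes[of t] by blast
  moreover obtain as bs where "gchildren t = as @ w # bs"
    using split_list[OF assms(2)] by blast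
  ultimately have "distinct (map label (nodes w))" by simp
  then show ?thesis
    using assms unfolding valid_tree_def by (auto simp: set_nodes[of t])
qed

text \<open>Splitting the list at \<open>w\<close> makes this a statement about positions, so that
  equal subtrees at two positions are excluded as well.\<close>

lemma valid_tree_disjoint:
  assumes "valid_tree k t" "gchildren t = as @ w # bs" "v \<in> set as \<union> set bs"
  shows "labels v \<inter> labels w = {}"
proof -
  have "distinct (map label (concat (map nodes (as @ w # bs))))"
    using assms(1,2) unfolding valid_tree_def distinct_label_nodes[of t] by simp
  then have "label ` set (nodes v) \<inter> label ` set (nodes w) = {}" using assms(3) by auto blast+
  then show ?thesis by (simp add: labels_def)
qed

lemma valid_tree_disjoint':
  assumes "valid_tree k t" "v \<in> set (gchildren t)" "w \<in> set (gchildren t)"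
    "x \<in> labels v" "x \<in> labels w"
  shows "v = w"
proof -
  obtain as bs where s: "gchildren t = as @ w # bs" using split_list[OF assms(3)] by blast
  then show ?thesis using valid_tree_disjoint[OF assms(1) s, of v] assms by auto
qed

lemma valid_treeI:
  assumes "distinct (map label (nodes t))" "pruned_node k t" "increasing_node t"
    "\<And>w. w \<in> set (gchildren t) \<Longrightarrow> valid_tree k w"
  shows "valid_tree k t"
  using assms unfolding valid_tree_def set_nodes[of t] by auto

lemma valid_tree_root: "valid_tree k t \<Longrightarrow> pruned_node k t" "valid_tree k t \<Longrightarrow> increasing_node t"
  by (auto simp: valid_tree_def)

lemma label_less_gchild: "valid_tree k t \<Longrightarrow> w \<in> set (gchildren t) \<Longrightarrow> label t < label w"
  using valid_tree_root(2) by (auto simp: increasing_node_def)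

lemma label_le_nodes: "valid_tree k t \<Longrightarrow> p \<in> set (nodes t) \<Longrightarrow> label t \<le> label p"
proof (induction t rule: ltree_gchildren_induct)
  case (gchildren t)
  show ?case
  proof (cases "p = t")
    case False
    then obtain w where w: "w \<in> set (gchildren t)" "p \<in> set (nodes w)"
      using gchildren.prems(2) by (auto simp: set_nodes[of t])
    then have "label w \<le> label p"
      using gchildren.IH[OF w(1)] valid_tree_gchild gchildren.prems(1) by blast
    then show ?thesis using label_less_gchild[OF gchildren.prems(1) w(1)] by simp
  qed simp
qed

lemma valid_tree_node: "valid_tree k t \<Longrightarrow> p \<in> set (nodes t) \<Longrightarrow> valid_tree k p"
proof (induction t rule: ltree_gchildren_induct)
  case (gchildren t)
  then show ?case using valid_tree_gchild by (auto simp: set_nodes[of t])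
qed

lemma gchildren_subset_nodes: "p \<in> set (nodes t) \<Longrightarrow> set (gchildren p) \<subseteq> set (nodes t)"
proof (induction t rule: ltree_gchildren_induct)
  case (gchildren t)
  then show ?case by (auto simp: set_nodes[of t])
qed

text \<open>A second grand parent would lie below some grand child \<open>w\<close> of the root.
  Then \<open>u\<close> occurs in \<open>w\<close> and, by disjointness, equals \<open>w\<close>,
  although labels increase strictly from \<open>w\<close> to \<open>u\<close>. Hence old and young,
  for a grand child of the root, refer to that root only.\<close>

lemma grand_parent_unique:
  assumes t: "valid_tree k t" and u: "u \<in> set (gchildren t)"
    and p: "p \<in> set (nodes t)" "u \<in> set (gchildren p)"
  shows "p = t"
proof (rule ccontr)
  assume "p \<noteq> t"
  then obtain w where w: "w \<in> set (gchildren t)" "p \<in> set (nodes w)"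
    using p(1) by (auto simp: set_nodes[of t])
  have vw: "valid_tree k w" using valid_tree_gchild[OF t w(1)] .
  have "label w \<le> label p" using label_le_nodes[OF vw w(2)] .
  also have "\<dots> < label u" using label_less_gchild[OF valid_tree_node[OF vw w(2)] p(2)] .
  finally have "label w < label u" .
  moreover have "label u \<in> labels w"
    using gchildren_subset_nodes[OF w(2)] p(2) by (auto simp: labels_def)
  then have "u = w" using valid_tree_disjoint'[OF t u w(1) label_in_labels] by simp
  ultimately show False by simp
qed

lemma old_gchild_greatest:
  assumes "valid_tree k t" "u \<in> set (gchildren t)" "u \<in> old_nodes t"
  shows "greatest_in u (gchildren t)"
  using assms grand_parent_unique unfolding old_nodes_def by blast

lemma young_gchild_not_greatest:
  assumes "valid_tree k t" "u \<in> set (gchildren t)" "u \<in> young_nodes t"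
  shows "\<not> greatest_in u (gchildren t)"
  using assms grand_parent_unique unfolding young_nodes_def by blast

section \<open>Old internal nodes and single contractions\<close>

definition old_internal :: "ltree \<Rightarrow> nat set" where
  "old_internal t = label ` {v \<in> old_nodes t. \<not> leaf v}"

lemma old_internal_eq:
  "old_internal t = label ` {v \<in> set (gchildren t). greatest_in v (gchildren t) \<and> \<not> leaf v} \<union>
     (\<Union>w\<in>set (gchildren t). old_internal w)"
  unfolding old_internal_def old_nodes_def set_nodes[of t] by blast

lemma old_internal_subset_labels: "old_internal t \<subseteq> labels t"
  using gchildren_subset_nodes unfolding old_internal_def old_nodes_def labels_def by blast

lemma root_not_old_internal: "valid_tree k t \<Longrightarrow> label t \<notin> old_internal t"
  unfolding old_internal_def old_nodes_def
  using label_less_gchild label_le_nodes valid_tree_node by fastforce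

lemma Oint_eq: "Oint F = (\<Union>t\<in>set F. old_internal t)"
  unfolding Oint_def old_internal_def by blast

text \<open>The list built by \<open>phi_local\<close> in case (i), as a function of the two lists
  of children, so that it is open to simultaneous induction on both.\<close>

definition pour :: "nat \<Rightarrow> ltree list list \<Rightarrow> ltree list list \<Rightarrow> ltree list list" where
  "pour x = map2 (\<lambda>\<mu> \<nu>. sort_key label (map (\<lambda>w. if label w = x then Node x [] else w) \<mu> @ \<nu>))"

text \<open>A case (i) application of \<open>\<Phi>\<^sub>x\<close>, with the path to the affected grand parent made explicit.\<close>

inductive contract :: "nat \<Rightarrow> ltree \<Rightarrow> ltree \<Rightarrow> bool" for x where
  root: "\<lbrakk>concat cs = as @ v # bs; label v = x; x \<notin> label ` set (as @ bs);
    greatest_in v (concat cs); \<not> leaf v\<rbrakk> \<Longrightarrow>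
    contract x (Node y cs) (Node y (pour x cs (children v)))"
| sub: "contract x w w' \<Longrightarrow>
    contract x (Node y (ps @ (as @ w # bs) # qs)) (Node y (ps @ (as @ w' # bs) # qs))"

lemma phi_notin_labels: "x \<notin> labels t \<Longrightarrow> phi x t = t"
proof (induction t)
  case (Node y cs)
  have "find (\<lambda>w. label w = x) (concat cs) = None"
    using Node.prems unfolding labels_eq[of "Node y cs"]
    by (auto simp: find_None_iff) (metis label_in_labels)
  moreover have "map (map (phi x)) cs = cs"
    by (intro map_idI, rule Node.IH) (use Node.prems in \<open>auto simp: labels_eq[of "Node y cs"]\<close>)
  ultimately show ?case by simp
qed

text \<open>Distinct labels make the search in \<open>phi\<close> exact: it finds the old node
  itself if that is a grand child of the root; otherwise it fails, and the recursion changes only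
  the one grand child that contains \<open>x\<close>.\<close>

lemma contract_phi: "valid_tree k t \<Longrightarrow> x \<in> old_internal t \<Longrightarrow> contract x t (phi x t)"
proof (induction t)
  case (Node y cs)
  note valid = Node.prems(1)
  have "(\<exists>v \<in> set (concat cs). greatest_in v (concat cs) \<and> \<not> leaf v \<and> label v = x) \<or>
      (\<exists>w\<in>set (concat cs). x \<in> old_internal w)"
    using Node.prems(2) unfolding old_internal_eq[of "Node y cs"] by auto
  then show ?case
  proof (elim disjE bexE conjE)
    fix v assume v: "v \<in> set (concat cs)" "greatest_in v (concat cs)" "\<not> leaf v" "label v = x"
    obtain as bs where ab: "concat cs = as @ v # bs" using split_list[OF v(1)] by blast
    have nx: "label w \<noteq> x" if "w \<in> set as \<union> set bs" for w
      using valid_tree_disjoint[OF valid, of as v bs w] ab that v(4)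
      by (metis disjoint_iff gchildren_Node label_in_labels)
    have "find (\<lambda>w. label w = x) (as @ v # bs) = Some v"
      using nx v(4) by (induction as) auto
    then have "phi x (Node y cs) = Node y (pour x cs (children v))"
      using v(2-4) by (simp add: ab[symmetric] phi_local_def pour_def)
    then show ?thesis using contract.root[OF ab v(4) _ v(2,3)] nx by auto
  next
    fix w assume w: "w \<in> set (concat cs)" "x \<in> old_internal w"
    then obtain c where c: "c \<in> set cs" "w \<in> set c" by auto
    obtain ps qs where pq: "cs = ps @ c # qs" using split_list[OF c(1)] by blast
    obtain as bs where ab: "c = as @ w # bs" using split_list[OF c(2)] by blast
    have vw: "valid_tree k w" using valid_tree_gchild[OF valid] w(1) by simp
    have xw: "x \<in> labels w" using w(2) old_internal_subset_labels by blast
    \<comment> \<open>Here \<open>x\<close> lies strictly below \<open>w\<close>, so the search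
      among the grand children of the root must fail.\<close>
    have "x \<noteq> label w" using root_not_old_internal[OF vw] w(2) by blast
    then have "label v \<noteq> x" if "v \<in> set (concat cs)" for v
      using valid_tree_disjoint'[OF valid, of v w x] xw w(1) that
      by (metis gchildren_Node label_in_labels)
    then have "find (\<lambda>w. label w = x) (concat cs) = None"
      by (auto simp: find_None_iff)
    \<comment> \<open>In this form the siblings of \<open>w\<close>, under whichever child of the
      root, are exactly the entries other than this occurrence of \<open>w\<close>.\<close>
    moreover have "concat cs = (concat ps @ as) @ w # (bs @ concat qs)" by (simp add: pq ab)
    then have "phi x v = v" if "v \<in> set ((concat ps @ as) @ (bs @ concat qs))" for v
      using valid_tree_disjoint[OF valid, of "concat ps @ as" w "bs @ concat qs" v] that xw
      by (intro phi_notin_labels) auto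
    then have "map (map (phi x)) ps = ps" "map (map (phi x)) qs = qs"
       "map (phi x) as = as" "map (phi x) bs = bs"
      by (auto intro!: map_idI)
    ultimately have "phi x (Node y cs) = Node y (ps @ (as @ phi x w # bs) # qs)"
      by (simp add: pq ab)
    then show ?thesis using contract.sub[OF Node.IH[OF c vw w(2)]] by (simp add: pq ab)
  qed
qed

section \<open>Effect of a contraction on labels, leaves and validity\<close>

lemma mset_concat_pour:
  "length cs = length ds \<Longrightarrow>
   mset (concat (pour x cs ds)) =
     image_mset (\<lambda>w. if label w = x then Node x [] else w) (mset (concat cs)) + mset (concat ds)"
  unfolding pour_def by (induction cs ds rule: list_induct2) auto

lemma mset_concat_pour_split:
  assumes "concat cs = as @ v # bs" "label v = x" "x \<notin> label ` set (as @ bs)"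
    and "length cs = length (children v)"
  shows "mset (concat (pour x cs (children v))) =
    add_mset (Node x []) (mset (as @ bs) + mset (gchildren v))"
proof -
  have "map (\<lambda>w. if label w = x then Node x [] else w) as = as"
    "map (\<lambda>w. if label w = x then Node x [] else w) bs = bs"
    using assms(3) by (auto intro!: map_idI)
  then have "map (\<lambda>w. if label w = x then Node x [] else w) (concat cs) = as @ Node x [] # bs"
    using assms(1,2) by simp
  then have "image_mset (\<lambda>w. if label w = x then Node x [] else w) (mset (concat cs)) =
      mset (as @ Node x [] # bs)"
    by (metis mset_map)
  then show ?thesis
    unfolding mset_concat_pour[OF assms(4)] by (simp add: gchildren_def)
qed

lemma set_concat_pour_split:
  assumes "concat cs = as @ v # bs" "label v = x" "x \<notin> label ` set (as @ bs)"
    and "length cs = length (children v)"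
  shows "set (concat (pour x cs (children v))) =
    insert (Node x []) (set (as @ bs) \<union> set (gchildren v))"
  using mset_concat_pour_split[OF assms]
  by (metis set_mset_add_mset_insert set_mset_mset set_mset_union)

text \<open>Internal nodes all have exactly \<open>k\<close> children, so \<open>map2\<close> in
  \<open>pour\<close> pairs them without truncation.\<close>

lemma same_arity:
  assumes "valid_tree k (Node y cs)" "v \<in> set (concat cs)" "\<not> leaf v"
  shows "length (children v) = length cs"
proof -
  have "valid_tree k v" using valid_tree_gchild[OF assms(1)] assms(2) by simp
  then show ?thesis
    using valid_tree_root(1)[of k v] valid_tree_root(1)[OF assms(1)] assms(2,3)
    by (auto simp: pruned_node_def leaf_def)
qed

lemma contract_root_label: "contract x t t' \<Longrightarrow> label t' = label t"
  by (induction rule: contract.induct) auto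

lemma contract_not_leaf: "contract x t t' \<Longrightarrow> \<not> leaf t"
  by (induction rule: contract.induct) (auto simp: leaf_def)

lemma contract_not_leaf': "contract x t t' \<Longrightarrow> valid_tree k t \<Longrightarrow> \<not> leaf t'"
proof (induction rule: contract.induct)
  case (root cs as v bs y)
  have "length (children v) = length cs" "cs \<noteq> []"
    using same_arity[OF root.prems] root.hyps by auto
  then show ?case by (auto simp: leaf_def pour_def)
qed (simp add: leaf_def)

text \<open>At the contracted node, \<open>v\<close> is traded for the leaf \<open>x\<close>
  together with the grand children of \<open>v\<close>, and these carry the same labels as
  \<open>v\<close> did.\<close>

lemma contract_label_mset:
  "contract x t t' \<Longrightarrow> valid_tree k t \<Longrightarrow> label_mset t' = label_mset t"
proof (induction rule: contract.induct)
  case (root cs as v bs y)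
  have m: "mset (concat (pour x cs (children v))) =
      add_mset (Node x []) (mset (as @ bs) + mset (gchildren v))"
    using mset_concat_pour_split[OF root.hyps(1-3)] same_arity[OF root.prems] root.hyps by auto
  have "label_mset v = add_mset x (\<Sum>w\<in>#mset (gchildren v). label_mset w)"
    using label_mset_eq[of v] root.hyps(2) by simp
  moreover have "label_mset (Node x []) = {#x#}" by (simp add: label_mset_eq[of "Node x []"])
  ultimately show ?case
    by (simp add: label_mset_eq[of "Node y _"] m root.hyps(1) del: mset_concat)
next
  case (sub w w' y ps as bs qs)
  have "valid_tree k w" using valid_tree_gchild[OF sub.prems] by simp
  then show ?case
    using sub.IH by (simp add: label_mset_eq[of "Node y _"])
qed

text \<open>The internal node \<open>v\<close> contributed only the leaves below it. These are kept,
  and the emptied node \<open>x\<close> is one more leaf.\<close>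

lemma contract_leaf_count:
  "contract x t t' \<Longrightarrow> valid_tree k t \<Longrightarrow> leaf_count t' = Suc (leaf_count t)"
proof (induction rule: contract.induct)
  case (root cs as v bs y)
  have ar: "length (children v) = length cs"
    using same_arity[OF root.prems] root.hyps by auto
  have m: "mset (concat (pour x cs (children v))) =
      add_mset (Node x []) (mset (as @ bs) + mset (gchildren v))"
    using mset_concat_pour_split[OF root.hyps(1-3)] ar by auto
  have "leaf_count v = (\<Sum>w\<in>#mset (gchildren v). leaf_count w)"
    using leaf_count_eq[of v] root.hyps(5) by simp
  moreover have "leaf_count (Node x []) = 1"
    by (simp add: leaf_count_eq[of "Node x []"] leaf_def)
  \<comment> \<open>The root contributes nothing to the count, before or after.\<close>
  moreover have "\<not> leaf (Node y cs)" "\<not> leaf (Node y (pour x cs (children v)))"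
    using contract.root[OF root.hyps] contract_not_leaf contract_not_leaf' root.prems by blast+
  ultimately show ?case
    by (simp add: leaf_count_eq[of "Node y _"] m root.hyps(1) del: mset_concat)
next
  case (sub w w' y ps as bs qs)
  have "valid_tree k w" using valid_tree_gchild[OF sub.prems] by simp
  then show ?case
    using sub.IH by (simp add: leaf_count_eq[of "Node y _"] leaf_def)
qed

lemma contract_distinct:
  "contract x t t' \<Longrightarrow> valid_tree k t \<Longrightarrow> distinct (map label (nodes t'))"
  using contract_label_mset[of x t t' k]
  by (metis label_mset_def mset_eq_imp_distinct_iff valid_tree_def)

lemma distinct_label_gchildren:
  assumes "distinct (map label (nodes t))"
  shows "distinct (map label (gchildren t))"
proof -
  have "distinct (map label (concat (map nodes ws))) \<Longrightarrow> distinct (map label ws)" for ws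
  proof (induction ws)
    case (Cons w ws)
    have "label w \<notin> label ` set ws"
    proof
      assume "label w \<in> label ` set ws"
      then obtain u where "u \<in> set ws" "label w = label u" by blast
      then have "label w \<in> label ` set (concat (map nodes ws))" by force
      moreover have "label w \<in> label ` set (nodes w)" by simp
      ultimately show False using Cons.prems by (auto simp del: root_in_nodes)
    qed
    then show ?case using Cons by simp
  qed simp
  then show ?thesis using assms distinct_label_nodes by blast
qed

lemma contract_valid_tree:
  "contract x t t' \<Longrightarrow> valid_tree k t \<Longrightarrow> valid_tree k t'"
proof (induction rule: contract.induct)
  case (root cs as v bs y)
  let ?t' = "Node y (pour x cs (children v))"
  have v: "v \<in> set (concat cs)" using root.hyps(1) by simp
  have ar: "length (children v) = length cs"
    using same_arity[OF root.prems] root.hyps by auto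
  have m: "set (concat (pour x cs (children v))) =
      insert (Node x []) (set (as @ bs) \<union> set (gchildren v))"
    using set_concat_pour_split[OF root.hyps(1-3) ar[symmetric]] .
  have vv: "valid_tree k v" using valid_tree_gchild[OF root.prems] v by simp
  have dist: "distinct (map label (nodes ?t'))"
    using contract_distinct[OF contract.root[OF root.hyps] root.prems] .
  show ?case
  proof (rule valid_treeI[OF dist])
    have "length cs = k" using valid_tree_root(1)[OF root.prems] root.hyps(1)
      by (auto simp: pruned_node_def)
    moreover have "gchildren ?t' \<noteq> []"
      using m unfolding gchildren_Node by (metis insert_not_empty set_empty)
    ultimately show "pruned_node k ?t'"
      using ar by (simp add: pruned_node_def pour_def del: gchildren_Node)
    \<comment> \<open>Sorting yields only a weak order; distinctness of all labels, inherited
      through the label multiset, makes it strict.\<close>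
    have "sorted_wrt (<) (map label c)" if c: "c \<in> set (pour x cs (children v))" for c
    proof -
      have "sorted (map label c)"
        using c unfolding pour_def by auto
      moreover have "distinct (map label c)"
        using distinct_label_gchildren[OF dist] split_list[OF c] by auto
      ultimately show ?thesis by (simp add: strict_sorted_iff)
    qed
    \<comment> \<open>The subtrees moved up from \<open>v\<close> have root labels above
      \<open>x\<close>, which is itself above \<open>y\<close>.\<close>
    moreover have "y < label w" if "w \<in> set (concat (pour x cs (children v)))" for w
    proof -
      have "y < x" using label_less_gchild[OF root.prems] v root.hyps(2) by force
      moreover have "x < label w" if "w \<in> set (gchildren v)"
        using label_less_gchild[OF vv that] root.hyps(2) by simp
      moreover have "y < label w" if "w \<in> set (as @ bs)"
        using label_less_gchild[OF root.prems, of w] root.hyps(1) that by auto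
      ultimately show ?thesis using that unfolding m by fastforce
    qed
    ultimately show "increasing_node ?t'" unfolding increasing_node_def by simp
    fix w assume "w \<in> set (gchildren ?t')"
    then consider "w = Node x []" | "w \<in> set (as @ bs)" | "w \<in> set (gchildren v)"
      unfolding gchildren_Node m by blast
    then show "valid_tree k w"
    proof cases
      case 1
      then show ?thesis
        by (simp add: valid_tree_def nodes_eq[of "Node x []"] pruned_node_def increasing_node_def)
    next
      case 2
      then show ?thesis using valid_tree_gchild[OF root.prems, of w] root.hyps(1) by auto
    next
      case 3
      then show ?thesis using valid_tree_gchild[OF vv] by blast
    qed
  qed
next
  case (sub w w' y ps as bs qs)
  let ?t = "Node y (ps @ (as @ w # bs) # qs)"
  have w: "valid_tree k w" using valid_tree_gchild[OF sub.prems] by simp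
  have l: "label w' = label w" using contract_root_label[OF sub.hyps] .
  show ?case
  proof (rule valid_treeI)
    show "distinct (map label (nodes (Node y (ps @ (as @ w' # bs) # qs))))"
      using contract_distinct[OF contract.sub[OF sub.hyps] sub.prems] .
    show "pruned_node k (Node y (ps @ (as @ w' # bs) # qs))"
      using valid_tree_root(1)[OF sub.prems] by (simp add: pruned_node_def)
    show "increasing_node (Node y (ps @ (as @ w' # bs) # qs))"
      using valid_tree_root(2)[OF sub.prems] l by (simp add: increasing_node_def)
    fix u assume "u \<in> set (gchildren (Node y (ps @ (as @ w' # bs) # qs)))"
    then have "u = w' \<or> u \<in> set (gchildren ?t)" by auto
    then show "valid_tree k u" using sub.IH[OF w] valid_tree_gchild[OF sub.prems] by blast
  qed
qed

section \<open>Old internal nodes under a contraction\<close>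

lemma greatest_in_iff:
  "u \<in> set ws \<Longrightarrow> greatest_in u ws \<longleftrightarrow> (\<forall>w\<in>set ws. label w \<le> label u)"
  unfolding greatest_in_def
  by (subst eq_commute, subst Max_eq_iff) auto

lemma greatest_in_cong: "label ` set ws = label ` set ws' \<Longrightarrow> greatest_in u ws = greatest_in u ws'"
  by (simp add: greatest_in_def)

text \<open>The greatest grand child of \<open>v\<close> exceeds \<open>x\<close>, and
  \<open>x\<close> bounds all former grand children of the root. So it is also the greatest after
  merging, and an old internal node below \<open>v\<close> stays old.\<close>

lemma contract_old_internal:
  "contract x t t' \<Longrightarrow> valid_tree k t \<Longrightarrow> old_internal t - {x} \<subseteq> old_internal t'"
proof (induction rule: contract.induct)
  case (root cs as v bs y)
  let ?t' = "Node y (pour x cs (children v))"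
  have v: "v \<in> set (concat cs)" using root.hyps(1) by simp
  have ar: "length (children v) = length cs"
    using same_arity[OF root.prems] root.hyps by auto
  have m: "set (concat (pour x cs (children v))) =
      insert (Node x []) (set (as @ bs) \<union> set (gchildren v))"
    using set_concat_pour_split[OF root.hyps(1-3) ar[symmetric]] .
  have vv: "valid_tree k v" using valid_tree_gchild[OF root.prems] v by simp
  have le: "label w \<le> x" if "w \<in> set (concat cs)" for w
    using greatest_in_iff[OF v] root.hyps(2,4) that by blast
  have sub: "old_internal w \<subseteq> old_internal ?t'" if "w \<in> set (as @ bs) \<union> set (gchildren v)" for w
    using that m unfolding old_internal_eq[of ?t'] gchildren_Node by blast
  have "old_internal v \<subseteq> old_internal ?t'"
  proof
    fix z assume "z \<in> old_internal v"
    then consider u where "u \<in> set (gchildren v)" "greatest_in u (gchildren v)" "\<not> leaf u" "label u = z"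
      | "z \<in> (\<Union>w\<in>set (gchildren v). old_internal w)"
      unfolding old_internal_eq[of v] by blast
    then show "z \<in> old_internal ?t'"
    proof cases
      case (1 u)
      have "x < label u" using label_less_gchild[OF vv 1(1)] root.hyps(2) by simp
      moreover have "\<forall>w\<in>set (gchildren v). label w \<le> label u"
        using greatest_in_iff[OF 1(1)] 1(2) by blast
      moreover have "\<forall>w\<in>set (as @ bs). label w \<le> x" using le root.hyps(1) by auto
      ultimately have "greatest_in u (concat (pour x cs (children v)))"
        using 1(1) by (subst greatest_in_iff; unfold m) fastforce+
      then show ?thesis
        using 1 m unfolding old_internal_eq[of ?t'] gchildren_Node by blast
    next
      case 2
      then show ?thesis using sub by blast
    qed
  qed
  moreover have "set (gchildren (Node y cs)) = insert v (set (as @ bs))"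
    by (simp add: root.hyps(1) del: set_concat)
  ultimately have "(\<Union>w\<in>set (gchildren (Node y cs)). old_internal w) \<subseteq> old_internal ?t'"
    using sub by (intro UN_least) auto
  \<comment> \<open>Being greatest is lost at this root only by \<open>x\<close>, which the claim
    leaves out.\<close>
  moreover have "label u = x" if "greatest_in u (gchildren (Node y cs))" for u
    using that root.hyps(2,4) by (simp add: greatest_in_def)
  ultimately show ?case
    unfolding old_internal_eq[of "Node y cs"] by blast
next
  case (sub w w' y ps as bs qs)
  let ?t = "Node y (ps @ (as @ w # bs) # qs)" and ?t' = "Node y (ps @ (as @ w' # bs) # qs)"
  have w: "valid_tree k w" using valid_tree_gchild[OF sub.prems] by simp
  have l: "label w' = label w" using contract_root_label[OF sub.hyps] .
  \<comment> \<open>The replaced grand child keeps its label and stays internal, so the root sees no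
    difference.\<close>
  have "greatest_in u (gchildren ?t) \<longleftrightarrow> greatest_in u (gchildren ?t')" for u
    by (rule greatest_in_cong) (simp add: l)
  moreover have "\<not> leaf w'" using contract_not_leaf'[OF sub.hyps w] .
  moreover have "greatest_in w ws \<longleftrightarrow> greatest_in w' ws" for ws by (simp add: greatest_in_def l)
  ultimately have "label ` {v \<in> set (gchildren ?t). greatest_in v (gchildren ?t) \<and> \<not> leaf v} \<subseteq>
      label ` {v \<in> set (gchildren ?t'). greatest_in v (gchildren ?t') \<and> \<not> leaf v}"
    using l by (force simp: image_iff)
  moreover have "(\<Union>w\<in>set (gchildren ?t). old_internal w) - {x} \<subseteq> (\<Union>w\<in>set (gchildren ?t'). old_internal w)"
    using sub.IH[OF w] by auto
  ultimately show ?case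
    unfolding old_internal_eq[of ?t] old_internal_eq[of ?t'] by blast
qed

section \<open>Removable leaves under a contraction\<close>

definition removable_old_labels :: "nat \<Rightarrow> ltree \<Rightarrow> nat set" where
  "removable_old_labels k t = label ` {u \<in> set (gchildren t). greatest_in u (gchildren t) \<and> leaf u \<and>
     (\<forall>w\<in>set (gchildren t). leaf w \<longrightarrow> w = u) \<and> first_children_leaves k t}"

lemma contract_removable_old_labels:
  assumes "contract x t t'" "valid_tree k t"
  shows "removable_old_labels k t' \<subseteq> removable_old_labels k t"
  using assms(1)
proof cases
  case (root cs as v bs y)
  have v: "v \<in> set (gchildren t)" using root(1,3) by simp
  have ar: "length (children v) = length cs"
    using same_arity assms(2) v root(1,7) by simp
  have m: "set (gchildren t') = insert (Node x []) (set (as @ bs) \<union> set (gchildren v))"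
    using set_concat_pour_split[OF root(3-5) ar[symmetric]] root(2) by simp
  have vv: "valid_tree k v" using valid_tree_gchild[OF assms(2) v] .
  then have "gchildren v \<noteq> []"
    using valid_tree_root(1)[OF vv] root(7) by (auto simp: pruned_node_def leaf_def)
  \<comment> \<open>An internal node of a pruned tree has a grand child; moved up, it lies above
    \<open>x\<close> and makes the new leaf \<open>x\<close> young.\<close>
  then obtain w where w: "w \<in> set (gchildren v)" by (meson hd_in_set)
  then have "x < label w" using label_less_gchild[OF vv w] root(4) by simp
  then have "\<not> greatest_in (Node x []) (gchildren t')"
    using w m by (subst greatest_in_iff) force+
  moreover have "leaf (Node x [])" by (simp add: leaf_def)
  \<comment> \<open>A removable old leaf is the only leaf among the grand children, so it would be
    the new leaf \<open>x\<close>, which is not the greatest.\<close>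
  ultimately have "removable_old_labels k t' = {}"
    using m unfolding removable_old_labels_def by auto
  then show ?thesis by simp
next
  case (sub w w' y ps as bs qs)
  have w: "valid_tree k w" using valid_tree_gchild[OF assms(2)] sub(1) by simp
  have g: "greatest_in u (gchildren t) \<longleftrightarrow> greatest_in u (gchildren t')" for u
    by (rule greatest_in_cong) (simp add: sub contract_root_label[OF sub(3)])
  have nl: "\<not> leaf w" "\<not> leaf w'"
    using contract_not_leaf contract_not_leaf' sub(3) w by blast+
  then have gc: "u \<in> set (gchildren t) \<longleftrightarrow> u \<in> set (gchildren t')" if "leaf u" for u
    using that by (auto simp: sub)
  \<comment> \<open>Only emptiness of children matters, and the changed child is nonempty on both
    sides. The cases are whether it falls outside or inside the first \<open>k - 1\<close>.\<close>
  have "first_children_leaves k t' \<longleftrightarrow> first_children_leaves k t"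
    by (cases "k - 1 - length ps") (auto simp: first_children_leaves_def sub)
  then show ?thesis
    unfolding removable_old_labels_def using g gc by auto
qed

text \<open>
  The bound on young leaves is what survives the contractions: a contraction at the root creates
  the young leaf \<open>x\<close>, which exceeds all earlier grand children, and only moves in larger labels.
\<close>

definition anchored :: "nat \<Rightarrow> ltree \<Rightarrow> bool" where
  "anchored k t \<longleftrightarrow> (\<exists>j<length (children t). j < k - 1 \<and> (\<exists>z\<in>label ` set (children t ! j).
     \<forall>u\<in>set (gchildren t). leaf u \<and> \<not> greatest_in u (gchildren t) \<longrightarrow> z \<le> label u))"

lemma contract_anchored:
  assumes "contract x t t'" "valid_tree k t" "anchored k t"
  shows "anchored k t'"
proof -
  obtain j z where j: "j < length (children t)" "j < k - 1" "z \<in> label ` set (children t ! j)"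
    and z: "\<And>u. u \<in> set (gchildren t) \<Longrightarrow> leaf u \<Longrightarrow> \<not> greatest_in u (gchildren t) \<Longrightarrow> z \<le> label u"
    using assms(3) unfolding anchored_def by blast
  show ?thesis using assms(1)
  proof cases
    case (root cs as v bs y)
    have v: "v \<in> set (gchildren t)" using root(1,3) by simp
    have ar: "length (children v) = length cs"
      using same_arity assms(2) v root(1,7) by simp
    have m: "set (gchildren t') = insert (Node x []) (set (as @ bs) \<union> set (gchildren v))"
      using set_concat_pour_split[OF root(3-5) ar[symmetric]] root(2) by simp
    have vv: "valid_tree k v" using valid_tree_gchild[OF assms(2) v] .
    obtain w where w: "w \<in> set (cs ! j)" "z = label w" using j(3) root(1) by auto
    then have "w \<in> set (concat cs)" using j(1) root(1) by auto
    \<comment> \<open>The anchor is a grand child of the root, and \<open>x\<close> was the greatest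
      of these.\<close>
    then have zx: "z \<le> x" using greatest_in_iff[of v "concat cs"] v root w(2) by auto
    have "z \<le> label u" if u: "u \<in> set (gchildren t')" "leaf u" for u
    proof -
      consider "u = Node x []" | "u \<in> set (as @ bs)" | "u \<in> set (gchildren v)"
        using u(1) m by blast
      then show ?thesis
      proof cases
        case 2
        \<comment> \<open>A leaf other than \<open>v\<close> was not the greatest, hence already
          young, and the old bound applies to it.\<close>
        then have "label u \<noteq> label v" using root(4,5) by (metis imageI)
        then have "\<not> greatest_in u (gchildren t)"
          using root(6) unfolding root(1) gchildren_Node greatest_in_def by metis
        then show ?thesis using z u(2) 2 root(1,3) by auto
      next
        case 3
        then show ?thesis using zx label_less_gchild[OF vv 3] root(4) by simp
      qed (use zx in simp)
    qed
    \<comment> \<open>\<open>pour\<close> only adds to each child of the root, and the emptied node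
      keeps its label and place, so the same \<open>j\<close> and \<open>z\<close> serve even if the
      anchor is \<open>v\<close>.\<close>
    moreover have "z \<in> label ` set (children t' ! j)" "j < length (children t')"
      using w j(1) ar root(1,2) by (auto simp: pour_def image_iff image_Un)
    ultimately show ?thesis using j(2) unfolding anchored_def by blast
  next
    case (sub w w' y ps as bs qs)
    have w: "valid_tree k w" using valid_tree_gchild[OF assms(2)] sub(1) by simp
    have l: "label w' = label w" using contract_root_label[OF sub(3)] .
    have g: "greatest_in u (gchildren t) \<longleftrightarrow> greatest_in u (gchildren t')" for u
      by (rule greatest_in_cong) (simp add: sub l)
    have "\<not> leaf w'" using contract_not_leaf' sub(3) w by blast
    then have "u \<in> set (gchildren t)" if "u \<in> set (gchildren t')" "leaf u" for u
      using that by (auto simp: sub)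
    moreover have "label ` set (children t' ! j) = label ` set (children t ! j)"
      by (auto simp: sub l nth_append nth_Cons' image_iff)
    moreover have "length (children t') = length (children t)" by (simp add: sub)
    ultimately show ?thesis using j z g unfolding anchored_def by metis
  qed
qed

lemma anchored_not_first_children_leaves:
  assumes "anchored k t"
  shows "\<not> first_children_leaves k t"
proof -
  obtain j where j: "j < length (children t)" "j < k - 1" "children t ! j \<noteq> []"
    using assms unfolding anchored_def by (metis empty_iff image_empty list.set(1))
  then have "children t ! j \<in> set (take (k - 1) (children t))"
    by (auto simp: in_set_conv_nth intro!: exI[of _ j])
  then show ?thesis using j(3) unfolding first_children_leaves_def by blast
qed

text \<open>Case (ii) moves only siblings with labels above that of \<open>u\<close>. The anchor is
  not above it and stays in its child, or is \<open>u\<close> itself, which gains children but is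
  not removed.\<close>

lemma anchored_phi_young_leaf:
  assumes "valid_tree k t" "anchored k t" "u \<in> set (gchildren t)" "leaf u"
    and "\<not> greatest_in u (gchildren t)"
  shows "\<not> first_children_leaves k (phi (label u) t)"
proof -
  obtain y cs where t: "t = Node y cs" by (cases t)
  obtain j w where j: "j < length cs" "j < k - 1" "w \<in> set (cs ! j)" "label w \<le> label u"
    using assms unfolding anchored_def t by auto
  have "distinct (map label (concat cs))"
    using distinct_label_gchildren assms(1) unfolding valid_tree_def t by fastforce
  then have inj: "inj_on label (set (concat cs))" by (simp add: distinct_map)
  have u: "u \<in> set (concat cs)" using assms(3) t by simp
  obtain v where v: "find (\<lambda>w. label w = label u) (concat cs) = Some v"
    using u by (cases "find (\<lambda>w. label w = label u) (concat cs)") (auto simp: find_None_iff)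
  then have "v \<in> set (concat cs)" "label v = label u"
    unfolding find_Some_iff by (auto simp del: set_concat)
  \<comment> \<open>The search returns some node with the label of \<open>u\<close>; distinct labels
    identify it with \<open>u\<close>.\<close>
  then have "v = u" using inj u by (auto dest: inj_onD simp del: set_concat)
  then have "children (phi (label u) t) ! j \<noteq> []" "j < length (children (phi (label u) t))"
    using v j assms(4,5) by (auto simp: t phi_local_def filter_empty_conv not_less Let_def)
  moreover from this have "children (phi (label u) t) ! j \<in> set (take (k - 1) (children (phi (label u) t)))"
    using j(2) by (auto simp: in_set_conv_nth intro!: exI[of _ j])
  ultimately show ?thesis unfolding first_children_leaves_def by blast
qed

section \<open>Composing the contractions\<close>

lemma fold_phi:
  assumes "valid_tree k t" "distinct xs" "set xs \<subseteq> old_internal t"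
  shows "valid_tree k (fold phi xs t)" "label_mset (fold phi xs t) = label_mset t"
    "label (fold phi xs t) = label t" "leaf (fold phi xs t) \<longleftrightarrow> leaf t"
    "leaf_count (fold phi xs t) = leaf_count t + length xs"
    "removable_old_labels k (fold phi xs t) \<subseteq> removable_old_labels k t"
    "anchored k t \<Longrightarrow> anchored k (fold phi xs t)"
  using assms
proof (atomize (full), induction xs arbitrary: t)
  case (Cons x xs)
  have valid: "valid_tree k t" using Cons.prems by simp
  have c: "contract x t (phi x t)" using contract_phi[of k t x] Cons.prems by auto
  \<comment> \<open>Distinctness keeps \<open>x\<close> out of \<open>xs\<close>, so all remaining
    labels are still old internal and the induction hypothesis applies to
    \<open>phi x t\<close>.\<close>
  have "set xs \<subseteq> old_internal (phi x t)"
    using contract_old_internal[OF c valid] Cons.prems by auto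
  then show ?case
    using Cons.IH[of "phi x t"] Cons.prems contract_valid_tree[OF c valid]
      contract_label_mset[OF c valid] contract_root_label[OF c] contract_not_leaf[OF c]
      contract_not_leaf'[OF c valid] contract_leaf_count[OF c valid]
      contract_removable_old_labels[OF c valid] contract_anchored[OF c valid]
    by simp (meson order_trans)
qed simp

lemma finite_labels [simp]: "finite (labels t)"
  by (simp add: labels_def)

lemma phi_set:
  assumes "valid_tree k t" "S \<subseteq> old_internal t"
  shows "valid_tree k (phi_set S t)" "label_mset (phi_set S t) = label_mset t"
    "label (phi_set S t) = label t" "leaf (phi_set S t) \<longleftrightarrow> leaf t"
    "leaf_count (phi_set S t) = leaf_count t + card S"
    "removable_old_labels k (phi_set S t) \<subseteq> removable_old_labels k t"
    "anchored k t \<Longrightarrow> anchored k (phi_set S t)"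
proof -
  \<comment> \<open>Finiteness matters: \<open>sorted_list_of_set\<close> of an infinite set is the
    empty list.\<close>
  have "finite S" using assms(2) old_internal_subset_labels finite_labels finite_subset by metis
  then have "set (sorted_list_of_set S) \<subseteq> old_internal t" "length (sorted_list_of_set S) = card S"
    using assms(2) by auto
  note * = fold_phi[OF assms(1) _ this(1), folded phi_set_def] this(2)
  show "valid_tree k (phi_set S t)" "label_mset (phi_set S t) = label_mset t"
    "label (phi_set S t) = label t" "leaf (phi_set S t) \<longleftrightarrow> leaf t"
    "leaf_count (phi_set S t) = leaf_count t + card S"
    "removable_old_labels k (phi_set S t) \<subseteq> removable_old_labels k t"
    "anchored k t \<Longrightarrow> anchored k (phi_set S t)"
    using * by simp_all
qed

section \<open>From trees to forests\<close>

lemma removable_old_eq: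
  assumes "\<forall>t\<in>set F. valid_tree k t"
  shows "removable_old k F = {x. \<exists>i<length F. x \<in> removable_old_labels k (F ! i) \<and>
     (Suc i < length F \<longrightarrow> x < label (F ! Suc i))}"
proof -
  \<comment> \<open>A grand child of the root has no other grand parent, so it is old exactly if it
    is greatest there.\<close>
  have "u \<in> old_nodes (F ! i) \<longleftrightarrow> greatest_in u (gchildren (F ! i))"
    if "i < length F" "u \<in> set (gchildren (F ! i))" for i u
    using old_gchild_greatest[of k "F ! i" u] assms that root_in_nodes[of "F ! i"]
    unfolding old_nodes_def by (auto simp del: root_in_nodes)
  then show ?thesis
    unfolding removable_old_def removable_old_labels_def by blast
qed

text \<open>Needed to read emptiness off a vanishing \<open>card\<close>, which is also 0 for
  infinite sets.\<close>

lemma finite_removable_old: "finite (removable_old k F)"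
proof (rule finite_subset)
  show "removable_old k F \<subseteq> (\<Union>t\<in>set F. label ` set (gchildren t))"
    unfolding removable_old_def by (fastforce simp: in_set_conv_nth)
qed simp

text \<open>Without young leaves the bound is vacuous, so any grand child under one of the first
  \<open>k - 1\<close> children can be the anchor.\<close>

lemma anchored_if_no_young_leaves:
  assumes "t \<in> set F" "Yleaf F = {}" "\<not> first_children_leaves k t"
  shows "anchored k t"
proof -
  obtain j where "j < length (children t)" "j < k - 1" "children t ! j \<noteq> []"
    using assms(3) unfolding first_children_leaves_def by (auto simp: in_set_conv_nth)
  moreover have "\<not> (leaf u \<and> \<not> greatest_in u (gchildren t))" if "u \<in> set (gchildren t)" for u
    using assms(1,2) that root_in_nodes[of t] unfolding Yleaf_def young_nodes_def by blast
  ultimately show ?thesis unfolding anchored_def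
    by (metis ex_in_conv image_is_empty set_empty)
qed

theorem lemma5p3:
  fixes n k :: nat and F F' :: "ltree list" and S :: "nat set"
  assumes "n \<ge> 1" and "k \<ge> 1"
    and "F \<in> forests_hat_star n k"
    and "S \<subseteq> Oint F"
    and "F' = Phi S F"
  shows "F' \<in> forests_hat n k \<and>
    rleaf k F' = 0 \<and>
    Si_star F' = Si_star F \<and>
    int (lleaf F') - int (si F') = int (lleaf F) - int (si F) + int (card S)"
proof -
  have F: "F \<in> forests n k" "F \<notin> forests_bar n k" "Yleaf F = {}" "rleaf k F = 0"
    using assms(3) by (auto simp: forests_hat_star_def forests_hat_def)
  have valid: "valid_tree k t" if "t \<in> set F" for t
    using F(1) that by (simp add: forests_def increasing_pruned_tree_on_labels_iff)
  have disj: "labels (F ! i) \<inter> labels (F ! j) = {}" if "i < length F" "j < length F" "i \<noteq> j" for i j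
  proof -
    have "i < j \<and> j < length F \<Longrightarrow> labels (F ! i) \<inter> labels (F ! j) = {}" for i j
      using F(1) unfolding forests_def by blast
    from this[of i j] this[of j i] show ?thesis using that by (auto simp: nat_neq_iff)
  qed
  have union: "(\<Union>t\<in>set F. labels t) = {1..n}" and roots: "sorted_wrt (<) (map label F)"
    using F(1) by (auto simp: forests_def)
  then have ne: "F \<noteq> []" using assms(1) by auto
  define g where "g t = phi_set (S \<inter> labels t) t" for t
  have F': "F' = map g F" by (simp add: assms(5) Phi_def g_def)
  \<comment> \<open>A label in \<open>S\<close> is old internal in some tree of \<open>F\<close>;
    since label sets are disjoint, that tree is \<open>t\<close>.\<close>
  have S: "S \<inter> labels t \<subseteq> old_internal t" if t: "t \<in> set F" for t
  proof
    fix x assume x: "x \<in> S \<inter> labels t"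
    then obtain t' where t': "t' \<in> set F" "x \<in> old_internal t'"
      using assms(4) by (auto simp: Oint_eq)
    then have "x \<in> labels t'" using old_internal_subset_labels by blast
    moreover obtain i j where "i < length F" "F ! i = t" "j < length F" "F ! j = t'"
      using t t'(1) by (auto simp: in_set_conv_nth)
    ultimately have "t = t'" using disj[of i j] x by auto
    then show "x \<in> old_internal t" using t' by simp
  qed
  note g = phi_set[OF valid S, folded g_def]
  have lab: "labels (g t) = labels t" if "t \<in> set F" for t
    using g(2)[OF that that] by (metis set_label_mset)
  have rl: "map label F' = map label F" by (simp add: F' g(3))
  have valid': "\<forall>t\<in>set F'. valid_tree k t" using g(1) by (auto simp: F')
  have "F' \<in> forests n k"
  proof -
    have "sorted_wrt (<) (map label F')" using roots rl by simp
    then show ?thesis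
      unfolding forests_def using disj union lab valid'
      by (auto simp: increasing_pruned_tree_on_labels_iff F')
  qed
  have lF: "last F \<in> set F" "last F' = g (last F)" "last F' \<in> set F'"
    using ne by (auto simp: F' last_map)
  have nl: "\<not> leaf (last F)" "\<not> first_children_leaves k (last F)"
    using F(1,2) by (auto simp: forests_bar_def)
  have nl': "\<not> leaf (last F')" using nl(1) lF g(4) by simp
  have anch: "anchored k (last F')"
    using anchored_if_no_young_leaves[OF lF(1) F(3) nl(2)] g(7) lF by simp
  have hat: "F' \<in> forests_hat n k"
    using \<open>F' \<in> forests n k\<close> nl' anchored_not_first_children_leaves[OF anch]
    by (simp add: forests_hat_def forests_bar_def)
  \<comment> \<open>A removable young leaf is a grand child of the last root, so the anchor of the
    last tree excludes it.\<close>
  have "removable_young k F' = {}"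
    using young_gchild_not_greatest anchored_phi_young_leaf anch valid' lF(3)
    unfolding removable_young_def by blast
  moreover have "removable_old k F' = {}"
  proof -
    have "removable_old k F = {}"
      using F(4) finite_removable_old by (simp add: rleaf_def)
    have "label (F' ! i) = label (F ! i)" if "i < length F" for i
      using that by (simp add: F' g(3))
    moreover have "removable_old_labels k (F' ! i) \<subseteq> removable_old_labels k (F ! i)" if "i < length F" for i
      using that g(6) by (simp add: F')
    moreover have "length F' = length F" by (simp add: F')
    ultimately have "removable_old k F' \<subseteq> removable_old k F"
      using valid removable_old_eq[OF valid'] removable_old_eq[of F k] by (simp, blast)
    then show ?thesis using \<open>removable_old k F = {}\<close> by blast
  qed
  ultimately have rleaf: "rleaf k F' = 0" by (simp add: rleaf_def)
  have "Si F' = Si F"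
  proof -
    have "x \<in> Si F' \<longleftrightarrow> (\<exists>t\<in>set F. leaf (g t) \<and> x = label (g t))" for x
      unfolding Si_def F' by auto
    moreover have "x \<in> Si F \<longleftrightarrow> (\<exists>t\<in>set F. leaf t \<and> x = label t)" for x
      unfolding Si_def by auto
    ultimately show ?thesis using g(3,4) by (intro set_eqI) (simp cong: bex_cong)
  qed
  \<comment> \<open>Neither last tree is a singleton, so \<open>Si_star\<close> is \<open>Si\<close>
    on both sides.\<close>
  then have Si: "Si_star F' = Si_star F" by (simp add: Si_star_def nl nl')
  have si: "si F' = si F"
  proof -
    have "filter (leaf \<circ> g) F = filter leaf F"
      by (intro filter_cong) (auto simp: g(4))
    then show ?thesis by (simp add: si_def F' filter_map)
  qed
  have ll: "lleaf G = (\<Sum>t\<leftarrow>G. leaf_count t)" for G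
    by (induction G) (auto simp: lleaf_def leaf_count_def)
  have "lleaf F' = (\<Sum>t\<leftarrow>F. leaf_count t + card (S \<inter> labels t))"
    unfolding ll F' map_map using g(5) by (intro arg_cong[where f = sum_list] map_cong) auto
  also have "\<dots> = lleaf F + (\<Sum>t\<leftarrow>F. card (S \<inter> labels t))"
    by (simp add: ll sum_list_addf)
  \<comment> \<open>Summing over positions lets the disjointness of the label sets turn the sum into
    the cardinality of a union, which is \<open>S\<close>.\<close>
  also have "(\<Sum>t\<leftarrow>F. card (S \<inter> labels t)) = (\<Sum>i<length F. card (S \<inter> labels (F ! i)))"
    by (simp add: sum_list_sum_nth atLeast0LessThan)
  also have "\<dots> = card (\<Union>i<length F. S \<inter> labels (F ! i))"
    by (rule card_UN_disjoint[symmetric]) (use disj in auto)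
  also have "(\<Union>i<length F. S \<inter> labels (F ! i)) = S"
  proof -
    have "S \<subseteq> (\<Union>t\<in>set F. labels t)"
      using assms(4) old_internal_subset_labels by (fastforce simp: Oint_eq)
    then show ?thesis by (fastforce simp: in_set_conv_nth)
  qed
  finally have "lleaf F' = lleaf F + card S" .
  then show ?thesis using hat rleaf Si si by simp
qed

end
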